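(* Let $0<p<1$ be a constant. For $N\ge 1$ let $G(N,p)$ be the random graph on vertex set $\{0,1,\dots,N-1\}$ in which each pair of distinct vertices is joined by an edge independently with probability $p$. Consider the cops and robber game with complementary edge sets played on $G(N,p)$, in which the robber moves along the edges of $G(N,p)$ and the cop moves along the edges of the complement graph of $G(N,p)$. Then the probability that the robber has a winning strategy tends to $1$ as $N\to\infty$.
   Context: Cops and robber game with complementary edge sets on a finite simple graph $G$ with vertex set $V$: one cop and one robber occupy vertices of $V$; graphs are treated as reflexive, so each player may also stay put as a move. The game is played with perfect information in a countable sequence of rounds with the cop and the robber moving alternately; the robber moves from his vertex to a vertex adjacent to it in $G$ (or stays), while the cop moves from her vertex to a vertex adjacent to it in the complement graph $\overline{G}$ (same vertex set, two distinct vertices adjacent iff they are not adjacent in $G$), or stays. The cop wins if after some finite number of rounds she occupies the same vertex as the robber; the robber wins if he avoids the cop forever in an infinite play. *)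

theory Defs
  imports "HOL-Probability.Probability" "HOL-Library.Ramsey"
begin

text \<open>
  A finite simple graph is given by a finite vertex set \<open>V\<close> and an edge set
  \<open>E \<subseteq> [V]\<^bsup>2\<^esup>\<close> of two-element subsets of \<open>V\<close>.
\<close>

definition complement_edges :: "'a set \<Rightarrow> 'a set set \<Rightarrow> 'a set set" where
  "complement_edges V E = [V]\<^bsup>2\<^esup> - E"

definition legal_move :: "'a set set \<Rightarrow> 'a \<Rightarrow> 'a \<Rightarrow> bool" where
  "legal_move E u v \<longleftrightarrow> u = v \<or> {u, v} \<in> E"

text \<open>
  The sequence of positions of one player: \<open>x 0\<close> is the vertex chosen at the start,
  \<open>x n\<close> the vertex occupied after the player's move in round \<open>n\<close>.
\<close>

definition legal_walk :: "'a set \<Rightarrow> 'a set set \<Rightarrow> (nat \<Rightarrow> 'a) \<Rightarrow> bool" where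
  "legal_walk V E x \<longleftrightarrow> x 0 \<in> V \<and> (\<forall>n. legal_move E (x n) (x (Suc n)))"

text \<open>
  In each round, including the placement round \<open>0\<close>, the cop acts first and the robber
  second. So the robber, on vertex \<open>r n\<close>, faces the cop on \<open>c n\<close> and then, after her next
  move, on \<open>c (Suc n)\<close>; being caught at either moment ends the game.
\<close>

definition captured :: "(nat \<Rightarrow> 'a) \<Rightarrow> (nat \<Rightarrow> 'a) \<Rightarrow> bool" where
  "captured c r \<longleftrightarrow> (\<exists>n. c n = r n \<or> c (Suc n) = r n)"

text \<open>
  A robber strategy maps the (cop, robber) positions of all completed rounds, together
  with the vertex the cop has just chosen in the current round, to the robber's vertex.
\<close>

type_synonym 'a robber_strategy = "('a \<times> 'a) list \<Rightarrow> 'a \<Rightarrow> 'a"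

definition follows :: "'a robber_strategy \<Rightarrow> (nat \<Rightarrow> 'a) \<Rightarrow> (nat \<Rightarrow> 'a) \<Rightarrow> bool" where
  "follows \<sigma> c r \<longleftrightarrow> (\<forall>n. r n = \<sigma> (map (\<lambda>i. (c i, r i)) [0..<n]) (c n))"

text \<open>
  Since the cop may always stay put, every finite legal course of her moves extends to an
  infinite one, so it suffices to quantify over infinite cop walks.
\<close>

definition robber_winning_strategy :: "'a set \<Rightarrow> 'a set set \<Rightarrow> 'a robber_strategy \<Rightarrow> bool" where
  "robber_winning_strategy V E \<sigma> \<longleftrightarrow>
     (\<forall>c r. legal_walk V (complement_edges V E) c \<longrightarrow> follows \<sigma> c r \<longrightarrow>
        legal_walk V E r \<and> \<not> captured c r)"

definition robber_wins :: "'a set \<Rightarrow> 'a set set \<Rightarrow> bool" where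
  "robber_wins V E \<longleftrightarrow> (\<exists>\<sigma>. robber_winning_strategy V E \<sigma>)"

definition random_graph :: "nat \<Rightarrow> real \<Rightarrow> nat set set pmf" where
  "random_graph N p =
     map_pmf (\<lambda>\<omega>. {e \<in> [{..<N}]\<^bsup>2\<^esup>. \<omega> e})
       (Pi_pmf ([{..<N}]\<^bsup>2\<^esup>) False (\<lambda>_. bernoulli_pmf p))"

end

theory Submission
  imports Defs "HOL-Real_Asymp.Real_Asymp"
begin

text \<open>
  The robber is safe after his move if he stands on a \<open>G\<close>-neighbour of the cop, because the
  cop cannot then step onto him. If any two distinct vertices have a common neighbour in \<open>G\<close>,
  he can restore this situation after every move of the cop. In \<open>G(N,p)\<close> a given pair has no
  common neighbour with probability \<open>(1 - p\<^sup>2)\<^bsup>N-2\<^esup>\<close>, so the union bound over all pairs tends to 0.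
\<close>

text \<open>\<open>E\<close> is an arbitrary set of sets and may contain singletons such as
  \<open>{u, u}\<close>, so \<open>w\<close> is kept apart from \<open>u\<close> and
  \<open>v\<close> explicitly.\<close>

definition common_neighbours :: "'a set \<Rightarrow> 'a set set \<Rightarrow> bool" where
  "common_neighbours V E \<longleftrightarrow> (\<forall>u\<in>V. \<forall>v\<in>V. u \<noteq> v \<longrightarrow>
     (\<exists>w\<in>V - {u, v}. {u, w} \<in> E \<and> {v, w} \<in> E))"

lemma legal_walk_complement_in:
  assumes "legal_walk V (complement_edges V E) c"
  shows "c n \<in> V"
proof (induction n)
  case 0
  show ?case using assms by (simp add: legal_walk_def)
next
  case (Suc n)
  have "legal_move (complement_edges V E) (c n) (c (Suc n))"
    using assms by (simp add: legal_walk_def)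
  then show ?case
    using Suc by (auto simp: legal_move_def complement_edges_def nsets_def)
qed

text \<open>The two distinct vertices serve the opening: on a single vertex
  \<open>common_neighbours\<close> holds vacuously, yet the robber is caught at once.\<close>

lemma robber_wins_if_common_neighbours:
  assumes cn: "common_neighbours V E" and two: "a \<in> V" "b \<in> V" "a \<noteq> b"
  shows "robber_wins V E"
proof -
  \<comment> \<open>The invariant after each robber move: an edge of \<open>E\<close> joins him to
    the cop's vertex \<open>c\<close>, so that edge is missing from her complement graph.\<close>
  define good where "good c z \<longleftrightarrow> z \<in> V \<and> z \<noteq> c \<and> {c, z} \<in> E" for c z
  define \<sigma> :: "'a robber_strategy" where
    \<comment> \<open>Only the robber's last vertex matters; with an empty history he places himself
      freely, so no adjacency is demanded.\<close>
    "\<sigma> h c = (SOME z. good c z \<and> (h \<noteq> [] \<longrightarrow> {snd (last h), z} \<in> E))" for h c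
  have step: "good c (\<sigma> h c) \<and> {snd (last h), \<sigma> h c} \<in> E"
    if h: "c \<in> V" "snd (last h) \<in> V" "c \<noteq> snd (last h)" "h \<noteq> []" for h c
  proof -
    obtain w where "w \<in> V - {c, snd (last h)}" "{c, w} \<in> E" "{snd (last h), w} \<in> E"
      using cn h unfolding common_neighbours_def by blast
    then have "\<exists>z. good c z \<and> (h \<noteq> [] \<longrightarrow> {snd (last h), z} \<in> E)"
      unfolding good_def by blast
    from someI_ex[OF this] show ?thesis
      using \<open>h \<noteq> []\<close> unfolding \<sigma>_def by blast
  qed
  have start: "good c (\<sigma> [] c)" if c: "c \<in> V" for c
  proof -
    \<comment> \<open>Any second vertex \<open>d\<close> will do: a common neighbour of
      \<open>c\<close> and \<open>d\<close> is in particular a neighbour of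
      \<open>c\<close>.\<close>
    obtain d where "d \<in> V" "d \<noteq> c" using two by metis
    then obtain w where "w \<in> V - {c, d}" "{c, w} \<in> E"
      using cn c unfolding common_neighbours_def by blast
    then have "\<exists>z. good c z" unfolding good_def by blast
    from someI_ex[OF this] show ?thesis unfolding \<sigma>_def by simp
  qed
  have "legal_walk V E r \<and> \<not> captured c r"
    if c: "legal_walk V (complement_edges V E) c" and r: "follows \<sigma> c r" for c r
  proof -
    have cV: "c n \<in> V" for n using c by (rule legal_walk_complement_in)
    have evade: "c (Suc n) \<noteq> r n" if "good (c n) (r n)" for n
    proof -
      have "legal_move (complement_edges V E) (c n) (c (Suc n))"
        using c by (simp add: legal_walk_def)
      then show ?thesis
        using that by (auto simp: legal_move_def complement_edges_def good_def)
    qed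
    have r0: "r 0 = \<sigma> [] (c 0)"
      using spec[OF r[unfolded follows_def], of 0] by simp
    have rSuc: "r (Suc n) = \<sigma> (map (\<lambda>i. (c i, r i)) [0..<Suc n]) (c (Suc n))" for n
      using r unfolding follows_def by blast
    have reply: "good (c (Suc n)) (r (Suc n)) \<and> {r n, r (Suc n)} \<in> E"
      if "good (c n) (r n)" for n
    proof -
      have "r n \<in> V" using that by (simp add: good_def)
      then show ?thesis
        \<comment> \<open>The history of rounds 0 to \<open>n\<close> is nonempty and ends in
          \<open>(c n, r n)\<close>; \<open>evade\<close> supplies the distinctness that
          \<open>step\<close> requires.\<close>
        using step[of "c (Suc n)" "map (\<lambda>i. (c i, r i)) [0..<Suc n]"] cV evade[OF that]
        unfolding rSuc by simp
    qed
    have inv: "good (c n) (r n)" for n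
      by (induction n) (use start cV r0 reply in auto)
    have "legal_walk V E r"
      using inv[of 0] inv reply by (auto simp: legal_walk_def legal_move_def good_def)
    moreover have "\<not> captured c r"
      using inv evade unfolding captured_def good_def by metis
    ultimately show ?thesis by blast
  qed
  then show ?thesis
    unfolding robber_wins_def robber_winning_strategy_def by blast
qed

text \<open>Cutting both sets down to the supports makes them countable, as the product rule
  requires, and changes no probability.\<close>

lemma prob_pair_pmf_Times:
  "measure_pmf.prob (pair_pmf M N) (A \<times> B) = measure_pmf.prob M A * measure_pmf.prob N B"
proof -
  have "(A \<times> B) \<inter> set_pmf (pair_pmf M N) = (A \<inter> set_pmf M) \<times> (B \<inter> set_pmf N)"
    by auto
  then have "measure_pmf.prob (pair_pmf M N) (A \<times> B) =
      measure_pmf.prob (pair_pmf M N) ((A \<inter> set_pmf M) \<times> (B \<inter> set_pmf N))"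
    by (metis measure_Int_set_pmf)
  also have "\<dots> = measure_pmf.prob M (A \<inter> set_pmf M) * measure_pmf.prob N (B \<inter> set_pmf N)"
    by (rule measure_pmf_prob_product) (auto intro: countable_subset[OF _ countable_set_pmf])
  finally show ?thesis
    by (simp add: measure_Int_set_pmf)
qed

text \<open>Independence of events that read disjoint sets of coordinates: the product over the
  union is glued from two independent samples, and the joint event pulls back to a
  rectangle.\<close>

lemma prob_Pi_pmf_Un_disjoint:
  assumes fin: "finite A" "finite B" and disj: "A \<inter> B = {}"
    and P: "\<And>f g. (\<And>x. x \<in> A \<Longrightarrow> f x = g x) \<Longrightarrow> P f \<longleftrightarrow> P g"
    and Q: "\<And>f g. (\<And>x. x \<in> B \<Longrightarrow> f x = g x) \<Longrightarrow> Q f \<longleftrightarrow> Q g"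
  shows "measure_pmf.prob (Pi_pmf (A \<union> B) d q) {f. P f \<and> Q f} =
         measure_pmf.prob (Pi_pmf A d q) {f. P f} * measure_pmf.prob (Pi_pmf B d q) {f. Q f}"
proof -
  define glue where "glue = (\<lambda>(f, g) x. if x \<in> A then f x else g x :: 'b)"
  have "P (glue (f, g)) \<longleftrightarrow> P f" for f g
    by (rule P) (auto simp: glue_def)
  moreover have "Q (glue (f, g)) \<longleftrightarrow> Q g" for f g
    by (rule Q) (use disj in \<open>auto simp: glue_def\<close>)
  ultimately have vim: "glue -` {f. P f \<and> Q f} = {f. P f} \<times> {g. Q g}"
    by auto
  have "Pi_pmf (A \<union> B) d q = map_pmf glue (pair_pmf (Pi_pmf A d q) (Pi_pmf B d q))"
    unfolding glue_def by (rule Pi_pmf_union[OF fin disj])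
  then show ?thesis
    by (simp only: measure_map_pmf vim prob_pair_pmf_Times)
qed

text \<open>Induction on \<open>W\<close>, splitting off one block of coordinates at a time.\<close>

lemma prob_Pi_pmf_disjoint_family:
  assumes "finite W" and "\<And>w. w \<in> W \<Longrightarrow> finite (S w)" and "disjoint_family_on S W"
    and "\<And>w f g. w \<in> W \<Longrightarrow> (\<And>x. x \<in> S w \<Longrightarrow> f x = g x) \<Longrightarrow> P w f \<longleftrightarrow> P w g"
  shows "measure_pmf.prob (Pi_pmf (\<Union>w\<in>W. S w) d q) {f. \<forall>w\<in>W. P w f} =
         (\<Prod>w\<in>W. measure_pmf.prob (Pi_pmf (S w) d q) {f. P w f})"
  using assms
proof (induction W rule: finite_induct)
  case empty
  show ?case by simp
next
  case (insert w W)
  have "measure_pmf.prob (Pi_pmf (S w \<union> (\<Union>w\<in>W. S w)) d q) {f. P w f \<and> (\<forall>w\<in>W. P w f)} =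
        measure_pmf.prob (Pi_pmf (S w) d q) {f. P w f} *
        measure_pmf.prob (Pi_pmf (\<Union>w\<in>W. S w) d q) {f. \<forall>w\<in>W. P w f}"
  proof (rule prob_Pi_pmf_Un_disjoint)
    show "S w \<inter> (\<Union>w\<in>W. S w) = {}"
      using insert.prems(2) insert.hyps(2) by (auto simp: disjoint_family_on_def)
    fix f g :: "'b \<Rightarrow> 'c"
    show "P w f \<longleftrightarrow> P w g" if "\<And>x. x \<in> S w \<Longrightarrow> f x = g x"
      using insert.prems(3)[of w f g] that by blast
    show "(\<forall>w\<in>W. P w f) \<longleftrightarrow> (\<forall>w\<in>W. P w g)" if "\<And>x. x \<in> (\<Union>w\<in>W. S w) \<Longrightarrow> f x = g x"
      by (intro ball_cong refl insert.prems(3)) (use that in auto)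
  qed (use insert.hyps insert.prems in auto)
  moreover have "measure_pmf.prob (Pi_pmf (\<Union>w\<in>W. S w) d q) {f. \<forall>w\<in>W. P w f} =
      (\<Prod>w\<in>W. measure_pmf.prob (Pi_pmf (S w) d q) {f. P w f})"
  proof (rule insert.IH)
    show "disjoint_family_on S W"
      using insert.prems(2) by (rule disjoint_family_on_mono[rotated]) auto
  qed (use insert.prems in blast)+
  ultimately show ?case
    using insert.hyps by simp
qed

lemma prob_Pi_bernoulli_not_both:
  assumes "a \<noteq> b" "0 \<le> p" "p \<le> 1"
  shows "measure_pmf.prob (Pi_pmf {a, b} False (\<lambda>_. bernoulli_pmf p)) {f. \<not> (f a \<and> f b)} = 1 - p\<^sup>2"
proof -
  let ?M = "Pi_pmf {a, b} False (\<lambda>_. bernoulli_pmf p)"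
  \<comment> \<open>Written as a box, the event falls under the product formula for
    \<open>Pi_pmf\<close>.\<close>
  have "measure_pmf.prob ?M {f. f a \<and> f b} = measure_pmf.prob ?M (Pi {a, b} (\<lambda>_. {True}))"
    by (rule arg_cong[where f = "measure_pmf.prob ?M"]) auto
  also have "\<dots> = p\<^sup>2"
    using assms by (subst measure_Pi_pmf_Pi) (auto simp: measure_pmf_single power2_eq_square)
  finally show ?thesis
    using measure_pmf.prob_neg[of ?M "\<lambda>f. f a \<and> f b"] by simp
qed

text \<open>Each of the \<open>N - 2\<close> candidates \<open>w\<close> fails with probability
  \<open>1 - p\<^sup>2\<close>, independently, since different candidates involve different
  edges.\<close>

lemma prob_no_common_neighbour:
  assumes p: "0 \<le> p" "p \<le> 1" and uv: "u < N" "v < N" "u \<noteq> v"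
  shows "measure_pmf.prob (random_graph N p)
           {E. \<forall>w\<in>{..<N} - {u, v}. \<not> ({u, w} \<in> E \<and> {v, w} \<in> E)} = (1 - p\<^sup>2) ^ (N - 2)"
proof -
  define W where "W = {..<N} - {u, v}"
  define S where "S w = {{u, w}, {v, w}}" for w
  let ?K = "[{..<N}]\<^bsup>2\<^esup>"
  let ?q = "\<lambda>_ :: nat set. bernoulli_pmf p"
  let ?P = "\<lambda>w f. \<not> (f {u, w} \<and> f {v, w})"
  have "finite W" and cardW: "card W = N - 2"
    using uv by (auto simp: W_def card_Diff_subset)
  have K: "{u, w} \<in> ?K \<and> {v, w} \<in> ?K" if "w \<in> W" for w
    using that uv by (auto simp: W_def nsets_def)
  have SK: "(\<Union>w\<in>W. S w) \<subseteq> ?K"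
    using K by (auto simp: S_def)
  have finK: "finite ?K"
    by (simp add: finite_imp_finite_nsets)
  have "measure_pmf.prob (random_graph N p) {E. \<forall>w\<in>W. \<not> ({u, w} \<in> E \<and> {v, w} \<in> E)} =
        measure_pmf.prob (Pi_pmf ?K False ?q) {f. \<forall>w\<in>W. ?P w f}"
    unfolding random_graph_def measure_map_pmf
    by (rule arg_cong[where f = "measure_pmf.prob _"]) (use K in auto)
  \<comment> \<open>The event ignores all edges outside the blocks \<open>S w\<close>, so these are
    marginalised away.\<close>
  also have "\<dots> = measure_pmf.prob (Pi_pmf (\<Union>w\<in>W. S w) False ?q) {f. \<forall>w\<in>W. ?P w f}"
    unfolding Pi_pmf_subset[OF finK SK] measure_map_pmf
    by (rule arg_cong[where f = "measure_pmf.prob _"]) (auto simp: S_def)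
  also have "\<dots> = (\<Prod>w\<in>W. measure_pmf.prob (Pi_pmf (S w) False ?q) {f. ?P w f})"
  proof (rule prob_Pi_pmf_disjoint_family)
    show "disjoint_family_on S W"
      \<comment> \<open>An edge shared by two blocks would force the two candidates to be equal, or
        one of them to lie in \<open>{u, v}\<close>.\<close>
      by (auto simp: disjoint_family_on_def S_def W_def doubleton_eq_iff)
  qed (use \<open>finite W\<close> in \<open>auto simp: S_def\<close>)
  also have "\<dots> = (\<Prod>w\<in>W. 1 - p\<^sup>2)"
    unfolding S_def
    by (intro prod.cong refl prob_Pi_bernoulli_not_both)
      (use uv p in \<open>auto simp: doubleton_eq_iff\<close>)
  finally show ?thesis
    by (simp add: cardW flip: W_def)
qed

lemma prob_not_common_neighbours_le:
  assumes p: "0 \<le> p" "p \<le> 1"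
  shows "measure_pmf.prob (random_graph N p) {E. \<not> common_neighbours {..<N} E}
           \<le> real N ^ 2 * (1 - p\<^sup>2) ^ (N - 2)"
proof -
  let ?M = "random_graph N p"
  define X where
    "X = (\<lambda>(u, v). {E. \<forall>w\<in>{..<N} - {u, v}. \<not> ({u, w} \<in> E \<and> {v, w} \<in> E)})"
  \<comment> \<open>Ordered pairs count each pair twice, but the crude bound \<open>N ^ 2\<close>
    suffices against geometric decay.\<close>
  define I where "I = {(u, v). u < N \<and> v < N \<and> u \<noteq> v}"
  have I: "I \<subseteq> {..<N} \<times> {..<N}" by (auto simp: I_def)
  have finI: "finite I" by (rule finite_subset[OF I]) simp
  have "card I \<le> card ({..<N} \<times> {..<N})" by (rule card_mono[OF _ I]) simp
  then have cardI: "card I \<le> N ^ 2" by (simp add: power2_eq_square)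
  have p2: "p\<^sup>2 \<le> 1" using p by (simp add: power_le_one)
  have "{E. \<not> common_neighbours {..<N} E} = (\<Union>i\<in>I. X i)"
    unfolding common_neighbours_def X_def I_def by blast
  then have "measure_pmf.prob ?M {E. \<not> common_neighbours {..<N} E}
      \<le> (\<Sum>i\<in>I. measure_pmf.prob ?M (X i))"
    using measure_pmf.finite_measure_subadditive_finite[OF finI, of X ?M] by simp
  also have "\<dots> = (\<Sum>i\<in>I. (1 - p\<^sup>2) ^ (N - 2))"
    unfolding X_def I_def
    by (intro sum.cong refl) (clarify, intro prob_no_common_neighbour[OF p])
  also have "\<dots> = real (card I) * (1 - p\<^sup>2) ^ (N - 2)" by simp
  also have "\<dots> \<le> real (N ^ 2) * (1 - p\<^sup>2) ^ (N - 2)"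
    using cardI p2 by (intro mult_right_mono) (auto simp del: of_nat_power)
  finally show ?thesis by simp
qed

theorem theorem5:
  fixes p :: real
  assumes "0 < p" and "p < 1"
  shows "(\<lambda>N. measure_pmf.prob (random_graph N p) {E. robber_wins {..<N} E}) \<longlonglongrightarrow> 1"
proof (rule tendsto_sandwich[where h = "\<lambda>_. 1"])
  define x where "x = 1 - p\<^sup>2"
  have x: "0 < x" "x < 1"
    using assms by (auto simp: x_def power_less_one_iff)
  have "(\<lambda>N. real N ^ 2 * x ^ (N - 2)) \<longlonglongrightarrow> 0"
  \<comment> \<open>Shifting by 2 removes the truncated subtraction in the exponent.\<close>
  proof (rule LIMSEQ_offset[where k = 2])
    show "(\<lambda>N. real (N + 2) ^ 2 * x ^ (N + 2 - 2)) \<longlonglongrightarrow> 0"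
      unfolding add_diff_cancel_right' using x by real_asymp
  qed
  from tendsto_diff[OF tendsto_const[of 1] this]
  show "(\<lambda>N. 1 - real N ^ 2 * (1 - p\<^sup>2) ^ (N - 2)) \<longlonglongrightarrow> 1"
    by (simp add: x_def)
  show "\<forall>\<^sub>F N in sequentially. 1 - real N ^ 2 * (1 - p\<^sup>2) ^ (N - 2)
      \<le> measure_pmf.prob (random_graph N p) {E. robber_wins {..<N} E}"
    \<comment> \<open>From \<open>N = 2\<close> on, 0 and 1 are the two distinct vertices that the
      opening needs.\<close>
    using eventually_ge_at_top[of 2]
  proof eventually_elim
    case (elim N)
    let ?M = "random_graph N p"
    have "1 - real N ^ 2 * (1 - p\<^sup>2) ^ (N - 2)
        \<le> 1 - measure_pmf.prob ?M {E. \<not> common_neighbours {..<N} E}"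
      using prob_not_common_neighbours_le[of p N] assms by simp
    also have "\<dots> = measure_pmf.prob ?M {E. common_neighbours {..<N} E}"
      using measure_pmf.prob_neg[of ?M "common_neighbours {..<N}"] by simp
    also have "\<dots> \<le> measure_pmf.prob ?M {E. robber_wins {..<N} E}"
      using elim robber_wins_if_common_neighbours[of "{..<N}" _ 0 1]
      by (intro measure_pmf.finite_measure_mono) auto
    finally show ?case .
  qed
qed auto

end
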